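(* Let $n\ge1$ and let $L\subset\mathbb{R}^n$ be a linear hyperplane (codimension $1$ subspace) in general position with respect to the reflection arrangement of type $B_n$, and let $H$ be either of the two open half-spaces with boundary $L$. Let $Q$ be sampled randomly and uniformly among the $2^n n!$ closed Weyl chambers $C^B_{\varepsilon,\sigma}$ of type $B_n$, and let $V_n$ be the number of vertices of the random simplex $Q\cap[-1,1]^n$ that lie in $H$. Then $V_n$ follows the discrete arcsine distribution: $$ \mathbb{P}[V_n=m]=\frac{1}{2^{2n}}\binom{2m}{m}\binom{2n-2m}{n-m},\qquad m=0,1,\ldots,n. $$
   Context: For $\varepsilon\in\{-1,+1\}^n$ and a permutation $\sigma$ of $\{1,\ldots,n\}$, the closed Weyl chamber of type $B_n$ is $$ C^B_{\varepsilon,\sigma}=\{(\beta_1,\ldots,\beta_n)\in\mathbb{R}^n:\ \varepsilon_1\beta_{\sigma(1)}\ge\varepsilon_2\beta_{\sigma(2)}\ge\ldots\ge\varepsilon_n\beta_{\sigma(n)}\ge 0\}. $$ Each $C^B_{\varepsilon,\sigma}\cap[-1,1]^n$ is a simplex with $n+1$ vertices (one of which is the origin). The reflection arrangement of type $B_n$ consists of the hyperplanes $\{\beta_i=\beta_j\}$ and $\{\beta_i=-\beta_j\}$ for $1\le i<j\le n$, and $\{\beta_i=0\}$ for $1\le i\le n$. Let $\mathcal{L}(B_n)$ be the set of all linear subspaces that are intersections of some of these hyperplanes (including $\mathbb{R}^n$ as the empty intersection). A hyperplane $L$ through the origin is in general position with respect to the arrangement if for every $K\in\mathcal{L}(B_n)$: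 $\dim(L\cap K)=\dim K-1$ if $\dim K\ge1$, and $\dim(L\cap K)=0$ if $\dim K\le 1$. *)

theory Defs
  imports "HOL-Analysis.Analysis" "HOL-Probability.Probability" "HOL-Combinatorics.Permutations"
begin

text \<open>
  \<open>\<real>\<^sup>n\<close> is \<^typ>\<open>real ^ 'n\<close> with \<open>n = CARD('n)\<close>. The order on the finite index type plays the
  role of the order on \<open>{1, \<dots>, n}\<close>. Every finite linear order of size \<open>n\<close> is isomorphic to it.
  The chain of inequalities defining a chamber is written for all pairs \<open>i \<le> j\<close>, since a linear
  order has no successor operation; likewise every term, not only the last, is stated to be
  nonnegative.
\<close>

definition sign_vectors :: "('n::finite \<Rightarrow> real) set" where
  "sign_vectors = {\<epsilon>. \<forall>i. \<epsilon> i = -1 \<or> \<epsilon> i = 1}"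

definition weyl_chamber_B ::
    "('n::{finite,linorder} \<Rightarrow> real) \<Rightarrow> ('n \<Rightarrow> 'n) \<Rightarrow> (real ^ 'n::{finite,linorder}) set" where
  "weyl_chamber_B \<epsilon> \<sigma> =
     {\<beta>. (\<forall>i j. i \<le> j \<longrightarrow> \<epsilon> i * \<beta> $ \<sigma> i \<ge> \<epsilon> j * \<beta> $ \<sigma> j) \<and> (\<forall>i. \<epsilon> i * \<beta> $ \<sigma> i \<ge> 0)}"

definition weyl_chambers_B :: "(real ^ 'n::{finite,linorder}) set set" where
  "weyl_chambers_B = {weyl_chamber_B \<epsilon> \<sigma> | \<epsilon> \<sigma>. \<epsilon> \<in> sign_vectors \<and> \<sigma> permutes UNIV}"

definition reflection_arrangement_B :: "(real ^ 'n::{finite,linorder}) set set" where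
  "reflection_arrangement_B =
     {{\<beta>. \<beta> $ i = \<beta> $ j} | i j. i < j} \<union>
     {{\<beta>. \<beta> $ i = - \<beta> $ j} | i j. i < j} \<union>
     {{\<beta>. \<beta> $ i = 0} | i. True}"

text \<open>The choice \<open>S = {}\<close> gives \<open>\<Inter>{} = UNIV\<close>, that is, the whole space.\<close>

definition intersection_lattice_B :: "(real ^ 'n::{finite,linorder}) set set" where
  "intersection_lattice_B = {\<Inter>S | S. S \<subseteq> reflection_arrangement_B}"

definition linear_hyperplane :: "(real ^ 'n::finite) set \<Rightarrow> bool" where
  "linear_hyperplane L \<longleftrightarrow> subspace L \<and> dim L + 1 = CARD('n)"

definition general_position_B :: "(real ^ 'n::{finite,linorder}) set \<Rightarrow> bool" where
  "general_position_B L \<longleftrightarrow>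
     (\<forall>K \<in> intersection_lattice_B.
        (dim K \<ge> 1 \<longrightarrow> dim (L \<inter> K) = dim K - 1) \<and> (dim K \<le> 1 \<longrightarrow> dim (L \<inter> K) = 0))"

definition open_half_space :: "(real ^ 'n::finite) set \<Rightarrow> bool" where
  "open_half_space H \<longleftrightarrow> (\<exists>a b. a \<noteq> 0 \<and> H = {x. a \<bullet> x > b})"

definition symmetric_cube :: "(real ^ 'n::finite) set" where
  "symmetric_cube = cbox (vec (-1)) (vec 1)"

definition num_vertices_in :: "(real ^ 'n::finite) set \<Rightarrow> (real ^ 'n::finite) set \<Rightarrow> nat" where
  "num_vertices_in H P = card {v \<in> H. v extreme_point_of P}"

lemma card_sign_vectors: "card (sign_vectors :: ('n::finite \<Rightarrow> real) set) = 2 ^ CARD('n)"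
proof -
  have eq: "(sign_vectors :: ('n \<Rightarrow> real) set) = PiE UNIV (\<lambda>_. {-1, 1})"
    by (auto simp: sign_vectors_def PiE_def Pi_def)
  show ?thesis
    unfolding eq by (subst card_PiE) (auto simp flip: numeral_2_eq_2)
qed

lemma weyl_chamber_B_inj:
  fixes \<epsilon> \<epsilon>' :: "'n::{finite,linorder} \<Rightarrow> real"
  assumes e: "\<epsilon> \<in> sign_vectors" and e': "\<epsilon>' \<in> sign_vectors"
    and s: "\<sigma> permutes UNIV" and s': "\<sigma>' permutes UNIV"
    and eq: "weyl_chamber_B \<epsilon> \<sigma> = weyl_chamber_B \<epsilon>' \<sigma>'"
  shows "\<epsilon> = \<epsilon>' \<and> \<sigma> = \<sigma>'"
proof -
  define r where "r = (\<lambda>i::'n. card {i..})"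
  define \<beta> :: "real ^ 'n::{finite,linorder}" where "\<beta> = (\<chi> k. \<epsilon> (inv \<sigma> k) * real (r (inv \<sigma> k)))"
  define \<tau> where "\<tau> = inv \<sigma> \<circ> \<sigma>'"
  have r_anti: "r j < r i" if "i < j" for i j
    unfolding r_def using that by (intro psubset_card_mono) auto
  have r_le: "r j \<le> r i" if "i \<le> j" for i j
    using r_anti[of i j] that by (cases "i = j") (auto simp: less_le)
  have r_pos: "r i > 0" for i unfolding r_def by (auto simp: card_gt_0_iff)
  have sq: "\<epsilon> i * \<epsilon> i = 1" for i using e by (auto simp: sign_vectors_def dest: spec[of _ i])
  have bs: "\<epsilon> i * \<beta> $ \<sigma> i = real (r i)" for i
    using sq[of i] permutes_inverses(2)[OF s] by (simp add: \<beta>_def)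
  have "\<beta> \<in> weyl_chamber_B \<epsilon> \<sigma>"
    using r_le by (auto simp: weyl_chamber_B_def bs)
  hence in': "\<beta> \<in> weyl_chamber_B \<epsilon>' \<sigma>'" using eq by simp
  have bs': "\<beta> $ \<sigma>' i = \<epsilon> (\<tau> i) * real (r (\<tau> i))" for i
    by (simp add: \<beta>_def \<tau>_def)
  have ee: "\<epsilon>' i = \<epsilon> (\<tau> i)" for i
  proof -
    have "\<epsilon>' i * (\<epsilon> (\<tau> i) * real (r (\<tau> i))) \<ge> 0"
      using in' by (auto simp: weyl_chamber_B_def bs')
    moreover have "\<epsilon>' i = -1 \<or> \<epsilon>' i = 1" "\<epsilon> (\<tau> i) = -1 \<or> \<epsilon> (\<tau> i) = 1"
      using e e' by (auto simp: sign_vectors_def)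
    ultimately show ?thesis using r_pos[of "\<tau> i"] by auto
  qed
  have "r (\<tau> j) \<le> r (\<tau> i)" if "i \<le> j" for i j
  proof -
    have "\<epsilon>' j * \<beta> $ \<sigma>' j \<le> \<epsilon>' i * \<beta> $ \<sigma>' i"
      using in' that by (auto simp: weyl_chamber_B_def)
    moreover have "\<epsilon>' k * \<beta> $ \<sigma>' k = real (r (\<tau> k))" for k
      using sq[of "\<tau> k"] by (simp add: bs' ee)
    ultimately show ?thesis by simp
  qed
  hence mono: "\<tau> i \<le> \<tau> j" if "i \<le> j" for i j
    using r_anti[of "\<tau> j" "\<tau> i"] that by (meson leD not_le)
  have bij: "bij \<tau>" unfolding \<tau>_def
    using s s' by (intro bij_comp permutes_bij permutes_inv)
  have "\<tau> ` {i..} = {\<tau> i..}" for i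
  proof
    show "{\<tau> i..} \<subseteq> \<tau> ` {i..}"
    proof
      fix k assume k: "k \<in> {\<tau> i..}"
      obtain j where j: "k = \<tau> j" using bij by (metis bij_pointE)
      have "i \<le> j"
        using k j mono[of j i] bij by (metis antisym atLeast_iff bij_pointE linear)
      thus "k \<in> \<tau> ` {i..}" using j by auto
    qed
  qed (use mono in auto)
  hence "r (\<tau> i) = r i" for i
    unfolding r_def using card_image[of \<tau> "{i..}"] bij
    by (metis bij_def inj_on_subset subset_UNIV)
  hence "\<tau> i = i" for i
    using r_anti[of i "\<tau> i"] r_anti[of "\<tau> i" i] by (metis less_irrefl neqE)
  hence t: "\<tau> = id" by auto
  have "\<sigma>' = \<sigma> \<circ> \<tau>"
    unfolding \<tau>_def using permutes_inv_o(1)[OF s] by (simp add: o_assoc)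
  thus ?thesis using t ee by auto
qed

lemma card_weyl_chambers_B:
  "card (weyl_chambers_B :: (real ^ 'n::{finite,linorder}) set set) = 2 ^ CARD('n) * fact CARD('n)"
proof -
  let ?S = "(sign_vectors :: ('n \<Rightarrow> real) set) \<times> {\<sigma>::'n \<Rightarrow> 'n. \<sigma> permutes UNIV}"
  have eq: "(weyl_chambers_B :: (real ^ 'n::{finite,linorder}) set set) =
      (\<lambda>(\<epsilon>, \<sigma>). weyl_chamber_B \<epsilon> \<sigma>) ` ?S"
    unfolding weyl_chambers_B_def by auto
  have inj: "inj_on (\<lambda>(\<epsilon>, \<sigma>). weyl_chamber_B \<epsilon> \<sigma>) ?S"
    by (intro inj_onI) (auto dest: weyl_chamber_B_inj)
  have perm: "card {\<sigma>::'n \<Rightarrow> 'n. \<sigma> permutes UNIV} = fact CARD('n)"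
    by (rule card_permutations) auto
  show ?thesis
    unfolding eq card_image[OF inj] by (simp add: card_cartesian_product card_sign_vectors perm)
qed

lemma finite_weyl_chambers_B: "finite (weyl_chambers_B :: (real ^ 'n::{finite,linorder}) set set)"
  using card_weyl_chambers_B[where 'n = 'n] by (intro card_ge_0_finite) simp

lemma weyl_chambers_B_nonempty: "(weyl_chambers_B :: (real ^ 'n::{finite,linorder}) set set) \<noteq> {}"
  using card_weyl_chambers_B[where 'n = 'n] by auto

end

theory Submission
  imports Defs
begin

text \<open>
  The vertices of the simplex are the partial sums of \<open>\<epsilon>\<^sub>1 e\<^bsub>\<sigma>(1)\<^esub>, \<dots>, \<epsilon>\<^sub>n e\<^bsub>\<sigma>(n)\<^esub>\<close>. So if \<open>H\<close> is
  \<open>a \<bullet> x > 0\<close>, then \<open>V\<^sub>n\<close> counts the positive partial sums of the random walk with steps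
  \<open>\<epsilon>\<^sub>i a\<^bsub>\<sigma>(i)\<^esub>\<close>, and general position says that no nontrivial signed subset sum of the coordinates
  of \<open>a\<close> vanishes. A rearrangement bijection going back to Sparre Andersen and Feller turns the
  number of positive partial sums into the first time the walk attains its maximum. Splitting
  there writes the counts for times \<open>0 < r < n\<close> as products of counts for walks on proper subsets
  of the steps, which are known by induction. Changing all signs shows that the counts for \<open>0\<close>
  and \<open>n\<close> agree, so they are determined by the total number \<open>2\<^sup>n n!\<close>.
\<close>

section \<open>First maxima, positive suffixes and the Feller rearrangement\<close>

fun max_prefix_sum :: "real list \<Rightarrow> real" where
  "max_prefix_sum [] = 0"
| "max_prefix_sum (x # xs) = max 0 (x + max_prefix_sum xs)"

text \<open>The strict inequality makes ties go to the earliest position at which the maximum is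
  attained; position 0 is the empty prefix, with sum 0.\<close>

fun first_max :: "real list \<Rightarrow> nat" where
  "first_max [] = 0"
| "first_max (x # xs) = (if x + max_prefix_sum xs > 0 then Suc (first_max xs) else 0)"

text \<open>
  Counting suffixes instead of prefixes matches the recursion on lists; the walk of a chamber is
  therefore read off in decreasing order of the indices.
\<close>

fun positive_suffixes :: "real list \<Rightarrow> nat" where
  "positive_suffixes [] = 0"
| "positive_suffixes (x # xs) = (if x + sum_list xs > 0 then 1 else 0) + positive_suffixes xs"

text \<open>Steps that start a suffix with positive sum come first, in their original order; the
  others follow in reverse order.\<close>

fun feller_rearrange :: "real list \<Rightarrow> real list" where
  "feller_rearrange [] = []"
| "feller_rearrange (x # xs) =
     (if x + sum_list xs > 0 then x # feller_rearrange xs else feller_rearrange xs @ [x])"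

lemma max_prefix_sum_nonneg: "max_prefix_sum xs \<ge> 0"
  by (cases xs) auto

lemma sum_list_le_max_prefix_sum: "sum_list xs \<le> max_prefix_sum xs"
  by (induction xs) auto

lemma max_prefix_sum_snoc:
  "max_prefix_sum (xs @ [x]) = max (max_prefix_sum xs) (sum_list xs + x)"
  by (induction xs) (auto simp: max_def)

text \<open>The only new prefix is the whole list, and it does not rise above the old
  maximum.\<close>

lemma first_max_snoc:
  "sum_list xs + x \<le> max_prefix_sum xs \<Longrightarrow> first_max (xs @ [x]) = first_max xs"
proof (induction xs)
  case (Cons y ys)
  show ?case
  proof (cases "sum_list ys + x \<le> max_prefix_sum ys")
    case True
    then show ?thesis using Cons.IH by (auto simp: max_prefix_sum_snoc max_def)
  next
    case False
    \<comment> \<open>Here \<open>y + max_prefix_sum ys < y + sum_list ys + x\<close>, so the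
      premise is possible only if both are at most 0, and then both first maxima are 0.\<close>
    then show ?thesis using Cons.prems by (auto simp: max_prefix_sum_snoc max_def split: if_splits)
  qed
qed auto

lemma mset_feller_rearrange [simp]: "mset (feller_rearrange xs) = mset xs"
  by (induction xs) auto

lemma sum_list_feller_rearrange [simp]: "sum_list (feller_rearrange xs) = sum_list xs"
  by (metis mset_feller_rearrange sum_mset_sum_list)

lemma length_feller_rearrange [simp]: "length (feller_rearrange xs) = length xs"
  by (metis mset_feller_rearrange size_mset)

text \<open>A step kept in front has a positive total after it, hence a positive maximum, and delays
  the first maximum by one. A step moved to the end makes the total at most 0, which is no new
  maximum.\<close>

lemma first_max_feller_rearrange: "first_max (feller_rearrange xs) = positive_suffixes xs"
proof (induction xs)
  case (Cons x xs)
  show ?case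
  proof (cases "x + sum_list xs > 0")
    case True
    then show ?thesis
      using Cons sum_list_le_max_prefix_sum[of "feller_rearrange xs"] by simp
  next
    case False
    then show ?thesis
      using Cons max_prefix_sum_nonneg[of "feller_rearrange xs"] by (simp add: first_max_snoc)
  qed
qed auto

text \<open>The total sum survives the rearrangement, and its sign tells whether the head went to
  the front or to the end, so each step can be undone.\<close>

lemma feller_rearrange_inj: "feller_rearrange xs = feller_rearrange ys \<Longrightarrow> xs = ys"
proof (induction xs arbitrary: ys)
  case Nil
  then show ?case by (metis feller_rearrange.simps(1) length_0_conv length_feller_rearrange)
next
  case (Cons x xs)
  then obtain y zs where ys: "ys = y # zs"
    by (metis length_feller_rearrange length_Suc_conv list.size(4) Suc_eq_plus1)
  have "sum_list (x # xs) = sum_list ys"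
    using Cons.prems by (metis sum_list_feller_rearrange)
  then have "x + sum_list xs = y + sum_list zs" by (simp add: ys)
  then have "x = y \<and> feller_rearrange xs = feller_rearrange zs"
    using Cons.prems by (auto simp: ys split: if_splits)
  then show ?case using Cons.IH ys by auto
qed

lemma first_max_le_length: "first_max xs \<le> length xs"
  by (induction xs) auto

text \<open>A second walk with first maximum 0 never rises above its start. The equality of the
  maxima is carried along because the recursion of \<open>first_max\<close> tests them.\<close>

lemma first_max_append:
  assumes "first_max us = length us" "first_max vs = 0"
  shows "first_max (us @ vs) = length us \<and> max_prefix_sum (us @ vs) = max_prefix_sum us"
  using assms
proof (induction us)
  case Nil
  then show ?case by (cases vs) (auto split: if_splits)
next
  case (Cons u us)
  then show ?case by (auto split: if_splits)
qed

lemma first_max_split: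
  "first_max (take (first_max zs) zs) = first_max zs \<and> first_max (drop (first_max zs) zs) = 0
   \<and> max_prefix_sum (take (first_max zs) zs) = max_prefix_sum zs"
  by (induction zs) auto

lemma positive_suffixes_uminus:
  assumes "\<And>k. k < length zs \<Longrightarrow> sum_list (drop k zs) \<noteq> 0"
  shows "positive_suffixes (map uminus zs) + positive_suffixes zs = length zs"
  using assms
proof (induction zs)
  case (Cons z zs)
  have "sum_list (drop k zs) \<noteq> 0" if "k < length zs" for k
    using Cons.prems[of "Suc k"] that by simp
  moreover have "z + sum_list zs \<noteq> 0"
    using Cons.prems[of 0] by simp
  moreover have "sum_list (map uminus zs) = - sum_list zs" by (induction zs) auto
  ultimately show ?case using Cons.IH by auto
qed auto

section \<open>Signed arrangements of a set of step sizes\<close>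

text \<open>
  The step sizes are pairwise distinct in absolute value by general position, so a signed
  permutation can be encoded by the list of its steps.
\<close>

definition signed_arrangements :: "real set \<Rightarrow> real list set" where
  "signed_arrangements A = {zs. distinct (map abs zs) \<and> abs ` set zs = A}"

text \<open>The arithmetic form of general position, to be applied to the absolute values of the
  coordinates of a normal vector: each size is used at most once, with either sign.\<close>

definition signed_sum_free :: "real set \<Rightarrow> bool" where
  "signed_sum_free A \<longleftrightarrow>
     (\<forall>zs. zs \<noteq> [] \<longrightarrow> distinct (map abs zs) \<longrightarrow> abs ` set zs \<subseteq> A \<longrightarrow> sum_list zs \<noteq> 0)"

lemma signed_sum_free_subset: "signed_sum_free A \<Longrightarrow> B \<subseteq> A \<Longrightarrow> signed_sum_free B"
  unfolding signed_sum_free_def by blast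

lemma Cons_signed_arrangements:
  "z # zs \<in> signed_arrangements A \<longleftrightarrow> \<bar>z\<bar> \<in> A \<and> zs \<in> signed_arrangements (A - {\<bar>z\<bar>})"
proof -
  have "distinct (map abs (z # zs)) \<and> insert \<bar>z\<bar> (abs ` set zs) = A \<longleftrightarrow>
      \<bar>z\<bar> \<in> A \<and> distinct (map abs zs) \<and> abs ` set zs = A - {\<bar>z\<bar>}"
    unfolding list.map distinct.simps list.set_map by blast
  then show ?thesis by (simp add: signed_arrangements_def)
qed

lemma append_signed_arrangements:
  assumes "us \<in> signed_arrangements B"
  shows "us @ vs \<in> signed_arrangements A \<longleftrightarrow> B \<subseteq> A \<and> vs \<in> signed_arrangements (A - B)"
proof -
  have B: "distinct (map abs us)" "B = abs ` set us"
    using assms by (simp_all add: signed_arrangements_def)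
  have "distinct (map abs us @ map abs vs) \<and> abs ` set us \<union> abs ` set vs = A \<longleftrightarrow>
      B \<subseteq> A \<and> distinct (map abs vs) \<and> abs ` set vs = A - B"
    unfolding distinct_append list.set_map B(2)[symmetric] using B(1) by blast
  then show ?thesis by (simp add: signed_arrangements_def image_Un)
qed

lemma length_signed_arrangement: "zs \<in> signed_arrangements A \<Longrightarrow> length zs = card A"
  unfolding signed_arrangements_def
  by (metis (mono_tags, lifting) distinct_card length_map list.set_map mem_Collect_eq)

lemma finite_signed_arrangements: "finite A \<Longrightarrow> finite (signed_arrangements A)"
proof -
  assume A: "finite A"
  have "signed_arrangements A \<subseteq> {zs. set zs \<subseteq> A \<union> uminus ` A \<and> length zs = card A}"
  proof safe
    fix zs z assume "zs \<in> signed_arrangements A" "z \<in> set zs" "z \<notin> uminus ` A"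
    then have "\<bar>z\<bar> \<in> A" "z \<noteq> - \<bar>z\<bar>" by (auto simp: signed_arrangements_def)
    then show "z \<in> A" by (auto simp: abs_if split: if_splits)
  qed (simp add: length_signed_arrangement)
  then show ?thesis
    by (rule finite_subset) (use A in \<open>intro finite_lists_length_eq finite_UnI finite_imageI\<close>)
qed

text \<open>The first entry is one of the \<open>2 * card A\<close> numbers \<open>x\<close> and
  \<open>- x\<close> with \<open>x\<close> in \<open>A\<close>, which positivity keeps distinct; the
  rest arranges the remaining sizes.\<close>

lemma card_signed_arrangements:
  assumes "finite A" "A \<subseteq> {0<..}"
  shows "card (signed_arrangements A) = 2 ^ card A * fact (card A)"
  using assms
proof (induction "card A" arbitrary: A)
  case 0
  then have "signed_arrangements A = {[]}" by (auto simp: signed_arrangements_def)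
  then show ?case using 0 by simp
next
  case (Suc n)
  let ?Z = "A \<union> uminus ` A"
  have cZ: "card ?Z = 2 * Suc n"
  proof -
    have "- x \<notin> A" if "x \<in> A" for x
      using Suc.prems(2) that by (meson greaterThan_iff less_asym neg_less_0_iff_less subsetD)
    then have "A \<inter> uminus ` A = {}" by auto
    then show ?thesis
      using Suc by (simp add: card_Un_disjoint card_image)
  qed
  have absZ: "\<bar>z\<bar> \<in> A" if "z \<in> ?Z" for z using that Suc.prems by force
  have "bij_betw (\<lambda>(z, zs). z # zs) (SIGMA z:?Z. signed_arrangements (A - {\<bar>z\<bar>}))
          (signed_arrangements A)"
  proof (rule bij_betw_imageI)
    show "(\<lambda>(z, zs). z # zs) ` (SIGMA z:?Z. signed_arrangements (A - {\<bar>z\<bar>})) = signed_arrangements A"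
    proof (intro equalityI subsetI)
      fix ys assume "ys \<in> (\<lambda>(z, zs). z # zs) ` (SIGMA z:?Z. signed_arrangements (A - {\<bar>z\<bar>}))"
      then show "ys \<in> signed_arrangements A"
        using absZ by (auto simp: Cons_signed_arrangements)
    next
      fix ys assume ys: "ys \<in> signed_arrangements A"
      then have "ys \<noteq> []" using Suc.hyps by (auto simp: signed_arrangements_def)
      then obtain z zs where z: "ys = z # zs" by (cases ys) auto
      then have zs: "\<bar>z\<bar> \<in> A" "zs \<in> signed_arrangements (A - {\<bar>z\<bar>})"
        using ys Cons_signed_arrangements by auto
      moreover have "z = \<bar>z\<bar> \<or> z = - \<bar>z\<bar>" by linarith
      then have "z \<in> ?Z" using zs(1) by (metis UnI1 UnI2 image_eqI)
      ultimately show "ys \<in> (\<lambda>(z, zs). z # zs) ` (SIGMA z:?Z. signed_arrangements (A - {\<bar>z\<bar>}))"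
        using z by auto
    qed
  qed (auto simp: inj_on_def)
  then have "card (signed_arrangements A) =
      card (SIGMA z:?Z. signed_arrangements (A - {\<bar>z\<bar>}))"
    using bij_betw_same_card by metis
  also have "\<dots> = (\<Sum>z\<in>?Z. card (signed_arrangements (A - {\<bar>z\<bar>})))"
    using Suc.prems by (intro card_SigmaI) (auto intro: finite_signed_arrangements)
  also have "\<dots> = (\<Sum>z\<in>?Z. 2 ^ n * fact n)"
  proof (rule sum.cong[OF refl])
    fix z assume z: "z \<in> ?Z"
    have "card (A - {\<bar>z\<bar>}) = n" using Suc absZ[OF z] by simp
    then show "card (signed_arrangements (A - {\<bar>z\<bar>})) = 2 ^ n * fact n"
      using Suc.hyps(1)[of "A - {\<bar>z\<bar>}"] Suc.prems by auto
  qed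
  also have "\<dots> = 2 ^ card A * fact (card A)"
    using cZ by (simp add: algebra_simps flip: Suc.hyps(2))
  finally show ?case .
qed

section \<open>Relations between the counts\<close>

text \<open>\<open>feller_rearrange\<close> only permutes entries, so it maps the finite set of
  arrangements into itself; being injective it is onto, and it turns
  \<open>positive_suffixes\<close> into \<open>first_max\<close>.\<close>

lemma card_first_max_eq_card_positive_suffixes:
  assumes "finite A"
  shows "card {zs \<in> signed_arrangements A. first_max zs = r} =
         card {zs \<in> signed_arrangements A. positive_suffixes zs = r}"
proof -
  have mem: "feller_rearrange zs \<in> signed_arrangements A" if "zs \<in> signed_arrangements A" for zs
  proof -
    have "mset (map abs (feller_rearrange zs)) = mset (map abs zs)" by simp
    then show ?thesis
      using that unfolding signed_arrangements_def
      by (metis (mono_tags, lifting) list.set_map mem_Collect_eq mset_eq_imp_distinct_iff mset_eq_setD)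
  qed
  have inj: "inj_on feller_rearrange (signed_arrangements A)"
    by (rule inj_onI) (rule feller_rearrange_inj)
  have "feller_rearrange ` signed_arrangements A = signed_arrangements A"
    using endo_inj_surj[OF finite_signed_arrangements[OF assms] _ inj] mem by blast
  then have "{zs \<in> signed_arrangements A. first_max zs = r} =
      feller_rearrange ` {zs \<in> signed_arrangements A. positive_suffixes zs = r}"
    by (auto simp: first_max_feller_rearrange image_iff) (metis first_max_feller_rearrange imageE)
  then show ?thesis
    by (simp add: card_image[OF inj_on_subset[OF inj]])
qed

text \<open>Since no nonempty suffix has sum 0, changing all signs replaces the number of positive
  suffixes by its complement in \<open>card A\<close>. The equidistribution above transfers this to
  first maxima.\<close>

lemma card_first_max_0:
  assumes A: "finite A" "signed_sum_free A"
  shows "card {zs \<in> signed_arrangements A. first_max zs = 0} =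
         card {zs \<in> signed_arrangements A. first_max zs = card A}"
proof -
  have nz: "sum_list (drop k zs) \<noteq> 0" if "zs \<in> signed_arrangements A" "k < length zs" for k zs
  proof -
    have "distinct (map abs (drop k zs))"
      using that(1) by (simp add: signed_arrangements_def flip: drop_map)
    moreover have "abs ` set (drop k zs) \<subseteq> A"
      using that(1) set_drop_subset[of k zs] by (auto simp: signed_arrangements_def)
    ultimately show ?thesis using A(2) that(2) by (auto simp: signed_sum_free_def)
  qed
  have mem: "map uminus zs \<in> signed_arrangements A" if "zs \<in> signed_arrangements A" for zs
    using that by (auto simp: signed_arrangements_def image_image o_def)
  have eq: "positive_suffixes (map uminus zs) + positive_suffixes zs = card A"
    if "zs \<in> signed_arrangements A" for zs
    using positive_suffixes_uminus[of zs] nz that length_signed_arrangement by metis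
  have inv: "map uminus (map uminus zs) = zs" for zs :: "real list" by (simp add: o_def)
  have "positive_suffixes (map uminus zs) = card A \<longleftrightarrow> positive_suffixes zs = 0"
    if "zs \<in> signed_arrangements A" for zs using eq[OF that] by linarith
  moreover have "positive_suffixes (map uminus zs) = 0 \<longleftrightarrow> positive_suffixes zs = card A"
    if "zs \<in> signed_arrangements A" for zs using eq[OF that] by linarith
  ultimately have "bij_betw (map uminus) {zs \<in> signed_arrangements A. positive_suffixes zs = 0}
          {zs \<in> signed_arrangements A. positive_suffixes zs = card A}"
    using mem by (intro bij_betw_byWitness[where f' = "map uminus"]) (auto simp: inv)
  then show ?thesis
    unfolding card_first_max_eq_card_positive_suffixes[OF A(1)] by (rule bij_betw_same_card)
qed

text \<open>Cut each arrangement at its first maximum, with \<open>B\<close> the set of step sizes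
  before the cut: the first piece has its first maximum at its end, the second never rises above its
  start.\<close>

lemma card_first_max_split:
  assumes A: "finite A"
  shows "card {zs \<in> signed_arrangements A. first_max zs = r} =
    (\<Sum>B | B \<subseteq> A \<and> card B = r. card {zs \<in> signed_arrangements B. first_max zs = card B} *
       card {zs \<in> signed_arrangements (A - B). first_max zs = 0})"
proof -
  let ?X = "\<lambda>B. {zs \<in> signed_arrangements B. first_max zs = card B}"
  let ?Y = "\<lambda>B. {zs \<in> signed_arrangements (A - B). first_max zs = 0}"
  let ?S = "SIGMA B:{B. B \<subseteq> A \<and> card B = r}. ?X B \<times> ?Y B"
  have "bij_betw (\<lambda>(B, us, vs). us @ vs) ?S {zs \<in> signed_arrangements A. first_max zs = r}"
  proof (rule bij_betw_imageI)
    show "inj_on (\<lambda>(B, us, vs). us @ vs) ?S"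
    proof (rule inj_onI)
      fix p q assume "p \<in> ?S" "q \<in> ?S"
        and eq: "(case p of (B, us, vs) \<Rightarrow> us @ vs) = (case q of (B, us, vs) \<Rightarrow> us @ vs)"
      then obtain B us vs B' us' vs' where pq: "p = (B, us, vs)" "q = (B', us', vs')"
        and h: "us \<in> signed_arrangements B" "us' \<in> signed_arrangements B'" "card B' = card B"
        by (cases p; cases q) auto
      \<comment> \<open>Equal cardinalities give equal lengths, so the concatenation determines
        where to cut.\<close>
      then have "length us = length us'" by (simp add: length_signed_arrangement)
      then have "us = us' \<and> vs = vs'" using eq by (simp add: pq)
      then show "p = q" using h by (auto simp: pq signed_arrangements_def)
    qed
    show "(\<lambda>(B, us, vs). us @ vs) ` ?S = {zs \<in> signed_arrangements A. first_max zs = r}"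
    proof (intro equalityI subsetI)
      fix zs assume "zs \<in> (\<lambda>(B, us, vs). us @ vs) ` ?S"
      then obtain B us vs where h: "zs = us @ vs" "B \<subseteq> A" "card B = r" "us \<in> ?X B" "vs \<in> ?Y B"
        by auto
      then have "length us = r" by (auto simp: length_signed_arrangement)
      then have "first_max zs = r" using h first_max_append[of us vs] by simp
      moreover have "zs \<in> signed_arrangements A"
        using h append_signed_arrangements[of us B] by simp
      ultimately show "zs \<in> {zs \<in> signed_arrangements A. first_max zs = r}" by auto
    next
      fix zs assume "zs \<in> {zs \<in> signed_arrangements A. first_max zs = r}"
      then have zs: "zs \<in> signed_arrangements A" "first_max zs = r" by auto
      define us vs where "us = take r zs" "vs = drop r zs"
      have app: "zs = us @ vs" by (simp add: us_vs_def)
      have len: "length us = r" using zs first_max_le_length[of zs] by (auto simp: us_vs_def)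
      define B where "B = abs ` set us"
      have "distinct (map abs us)"
        using zs(1) by (simp add: signed_arrangements_def app)
      then have us: "us \<in> signed_arrangements B"
        by (simp add: signed_arrangements_def B_def)
      have cB: "card B = r" using length_signed_arrangement[OF us] len by simp
      have "B \<subseteq> A" "vs \<in> signed_arrangements (A - B)"
        using zs(1) append_signed_arrangements[OF us] app by simp_all
      moreover have "first_max us = r" "first_max vs = 0"
        using first_max_split[of zs] zs(2) by (simp_all add: us_vs_def)
      ultimately have "(B, us, vs) \<in> ?S" using us cB by simp
      then show "zs \<in> (\<lambda>(B, us, vs). us @ vs) ` ?S"
        using app by (intro image_eqI[where x = "(B, us, vs)"]) simp_all
    qed
  qed
  then have "card {zs \<in> signed_arrangements A. first_max zs = r} = card ?S"
    by (rule bij_betw_same_card[symmetric])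
  also have "\<dots> = (\<Sum>B | B \<subseteq> A \<and> card B = r. card (?X B \<times> ?Y B))"
    using A finite_signed_arrangements[OF finite_subset[OF _ A]]
    by (intro card_SigmaI ballI finite_cartesian_product) simp_all
  finally show ?thesis by (simp add: card_cartesian_product)
qed

section \<open>Central binomial coefficients\<close>

text \<open>These are the coefficients of \<open>(1 - 4 x)\<close> to the power \<open>-1/2\<close>;
  both sides obey the recurrence \<open>(k + 1) c(k + 1) = 2 (2 k + 1) c(k)\<close>.\<close>

lemma central_binomial_gbinomial:
  "real ((2 * k) choose k) = (-4) ^ k * ((-1/2) gchoose k)"
proof (induction k)
  case (Suc k)
  have "real (Suc k) * real ((2 * Suc k) choose Suc k) = 2 * (2 * real k + 1) * real ((2 * k) choose k)"
  proof -
    have "Suc k * ((2 * Suc k) choose Suc k) = (2 * Suc k) * (Suc (2 * k) choose k)"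
      using Suc_times_binomial[of k "Suc (2 * k)"] by simp
    moreover have "Suc k * (Suc (2 * k) choose k) = Suc (2 * k) * ((2 * k) choose k)"
      using Suc_times_binomial[of k "2 * k"] binomial_symmetric[of k "Suc (2*k)"] by simp
    ultimately have "Suc k * (Suc k * ((2 * Suc k) choose Suc k)) =
        Suc k * (2 * (2 * k + 1) * ((2 * k) choose k))"
      by (simp only: mult.assoc mult.left_commute) (simp add: algebra_simps)
    then have "Suc k * ((2 * Suc k) choose Suc k) = 2 * (2 * k + 1) * ((2 * k) choose k)"
      by (simp only: mult_cancel1) simp
    then have "real (Suc k * ((2 * Suc k) choose Suc k)) = real (2 * (2 * k + 1) * ((2 * k) choose k))"
      by (rule arg_cong)
    then show ?thesis by (simp only: of_nat_mult of_nat_add of_nat_numeral of_nat_1)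
  qed
  then have "real ((2 * Suc k) choose Suc k) = 2 * (2 * real k + 1) / real (Suc k) * real ((2 * k) choose k)"
    by (simp only: nonzero_eq_divide_eq[OF of_nat_neq_0] times_divide_eq_left mult.commute[of "real (Suc k)"])
  moreover have "2 * (2 * real k + 1) / real (Suc k) * ((-4) ^ k * g) =
      (-4) ^ Suc k * ((-1/2 - real k) / real (Suc k) * g)" for g
    by (simp add: field_simps)
  moreover have "(- 1 / 2 :: real) gchoose Suc k = (-1/2 - real k) / real (Suc k) * ((-1/2) gchoose k)"
    using gbinomial_absorb_comp[of "-1/2 :: real" k] gbinomial_absorption[of k "-1/2 :: real"]
    by (simp add: field_simps)
  ultimately show ?case using Suc by simp
qed simp

text \<open>Vandermonde convolution with both exponents \<open>-1/2\<close>: squaring the generating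
  function gives the geometric series of \<open>1 / (1 - 4 x)\<close>.\<close>

lemma sum_central_binomial_convolution:
  "(\<Sum>k\<le>n. real ((2 * k) choose k) * real ((2 * (n - k)) choose (n - k))) = 4 ^ n"
proof -
  have "(\<Sum>k\<le>n. real ((2 * k) choose k) * real ((2 * (n - k)) choose (n - k))) =
     (\<Sum>k\<le>n. (-4) ^ n * (((-1/2) gchoose k) * ((-1/2) gchoose (n - k))))"
  proof (rule sum.cong)
    fix k assume "k \<in> {..n}"
    then have "(-4 :: real) ^ n = (-4) ^ k * (-4) ^ (n - k)" by (simp flip: power_add)
    then show "real ((2 * k) choose k) * real ((2 * (n - k)) choose (n - k)) =
        (-4) ^ n * (((-1/2) gchoose k) * ((-1/2) gchoose (n - k)))"
      by (simp only: central_binomial_gbinomial mult.assoc mult.left_commute)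
  qed simp
  also have "\<dots> = (-4) ^ n * ((-1/2 + -1/2) gchoose n)"
    using gbinomial_Vandermonde[of "-1/2 :: real" "-1/2" n]
    by (simp flip: sum_distrib_left add: atMost_atLeast0)
  also have "((-1/2 + -1/2) gchoose n) = (-1 :: real) ^ n"
    using gbinomial_minus[of "1::real" n] by (simp flip: binomial_gbinomial)
  finally show ?thesis by (simp flip: power_mult_distrib)
qed

section \<open>Evaluating the counts by induction\<close>

text \<open>
  By \<open>card_first_max\<close> below, this is the number of signed arrangements of \<open>k\<close> steps all of whose
  partial sums are positive; it equals \<open>1 \<cdot> 3 \<cdots> (2k - 1)\<close>.
\<close>

definition positive_walks :: "nat \<Rightarrow> real" where
  "positive_walks k = fact k * real ((2 * k) choose k) / 2 ^ k"

text \<open>Passes from the product form, which suits the recursion, to arcsine weights times the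
  number of arrangements. The factorials in \<open>positive_walks\<close> cancel against those of
  the binomial coefficient.\<close>

lemma binomial_positive_walks:
  assumes "r \<le> n"
  shows "real (n choose r) * positive_walks r * positive_walks (n - r) =
    2 ^ n * fact n * (real ((2 * r) choose r) * real ((2 * (n - r)) choose (n - r)) / 4 ^ n)"
proof -
  have "(2::real) ^ n = 2 ^ r * 2 ^ (n - r)" using assms by (simp flip: power_add)
  moreover have "(4::real) ^ n = 2 ^ n * 2 ^ n" by (simp flip: power_mult_distrib)
  ultimately show ?thesis
    using assms by (simp add: positive_walks_def binomial_fact field_simps)
qed

lemma card_first_max:
  assumes "finite A" "A \<subseteq> {0<..}" "signed_sum_free A" "r \<le> card A"
  shows "real (card {zs \<in> signed_arrangements A. first_max zs = r}) =
    real (card A choose r) * positive_walks r * positive_walks (card A - r)"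
  using assms
proof (induction "card A" arbitrary: A r rule: less_induct)
  case less
  note A = less.prems(1-3)
  define n where "n = card A"
  let ?N = "\<lambda>r. real (card {zs \<in> signed_arrangements A. first_max zs = r})"
  let ?D = "\<lambda>r. real (n choose r) * positive_walks r * positive_walks (n - r)"
  \<comment> \<open>For \<open>0 < r < n\<close> both \<open>B\<close> and \<open>A - B\<close> are
    proper subsets of \<open>A\<close>, so the induction hypothesis gives both factors.\<close>
  have mid: "?N r = ?D r" if r: "0 < r" "r < n" for r
  proof -
    have "?N r = (\<Sum>B | B \<subseteq> A \<and> card B = r.
        real (card {zs \<in> signed_arrangements B. first_max zs = card B}) *
        real (card {zs \<in> signed_arrangements (A - B). first_max zs = 0}))"
      by (simp add: card_first_max_split[OF A(1)])
    also have "\<dots> = (\<Sum>B | B \<subseteq> A \<and> card B = r. positive_walks r * positive_walks (n - r))"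
    proof (rule sum.cong[OF refl], clarify)
      fix B assume B: "B \<subseteq> A" "r = card B"
      have fB: "finite B" using B A finite_subset by blast
      have cAB: "card (A - B) = n - card B" using B fB by (simp add: card_Diff_subset n_def)
      \<comment> \<open>At the extreme values of the first maximum the product formula reduces to a
        single factor, because \<open>positive_walks 0\<close> is 1.\<close>
      have "real (card {zs \<in> signed_arrangements B. first_max zs = card B}) = positive_walks (card B)"
        using less.hyps[of B "card B"] A B fB r signed_sum_free_subset[OF A(3), of B]
        by (simp add: n_def positive_walks_def[of 0] subset_trans)
      moreover have "real (card {zs \<in> signed_arrangements (A - B). first_max zs = 0}) =
          positive_walks (n - card B)"
        using less.hyps[of "A - B" 0] A B r cAB signed_sum_free_subset[OF A(3), of "A - B"]
        by (simp add: n_def positive_walks_def[of 0] subset_trans[OF Diff_subset])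
      ultimately show "real (card {zs \<in> signed_arrangements B. first_max zs = card B}) *
          real (card {zs \<in> signed_arrangements (A - B). first_max zs = 0}) =
          positive_walks (card B) * positive_walks (n - card B)" by simp
    qed
    also have "\<dots> = ?D r" using n_subsets[OF A(1), of r] by (simp add: n_def)
    finally show ?thesis .
  qed
  have sumN: "(\<Sum>r\<le>n. ?N r) = 2 ^ n * fact n"
  proof -
    have "signed_arrangements A = (\<Union>r\<le>n. {zs \<in> signed_arrangements A. first_max zs = r})"
      using length_signed_arrangement[of _ A] first_max_le_length by (auto simp: n_def) metis
    then have "card (signed_arrangements A) =
        card (\<Union>r\<le>n. {zs \<in> signed_arrangements A. first_max zs = r})" by simp
    also have "\<dots> = (\<Sum>r\<le>n. card {zs \<in> signed_arrangements A. first_max zs = r})"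
      using finite_signed_arrangements[OF A(1)] by (intro card_UN_disjoint) auto
    finally have "(\<Sum>r\<le>n. card {zs \<in> signed_arrangements A. first_max zs = r}) = 2 ^ n * fact n"
      using card_signed_arrangements[OF A(1,2)] by (simp add: n_def)
    then show ?thesis
      unfolding of_nat_sum[symmetric] by simp
  qed
  \<comment> \<open>The claimed values have the same total as the counts, which leaves only the two
    end terms to be compared.\<close>
  have sumD: "(\<Sum>r\<le>n. ?D r) = 2 ^ n * fact n"
    by (simp add: binomial_positive_walks sum_central_binomial_convolution
          flip: sum_distrib_left sum_divide_distrib)
  have N0: "?N 0 = ?N n" using card_first_max_0[OF A(1,3)] by (simp add: n_def)
  have "?N 0 = ?D 0"
  \<comment> \<open>For \<open>n = 0\<close> the indices 0 and \<open>n\<close> coincide and cannot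
    be split off separately.\<close>
  proof (cases "n = 0")
    case True
    then show ?thesis using sumN by (simp add: positive_walks_def)
  next
    case False
    have split: "{..n} = insert 0 (insert n {0<..<n})" using False by auto
    have "sum ?N {0<..<n} = sum ?D {0<..<n}" by (rule sum.cong) (auto simp: mid)
    moreover have "(\<Sum>r\<le>n. f r) = f 0 + f n + sum f {0<..<n}" for f :: "nat \<Rightarrow> real"
      unfolding split using False by simp
    note this[of ?N] this[of ?D]
    ultimately have "?N 0 + ?N n = ?D 0 + ?D n" using sumN sumD by linarith
    moreover have "?D 0 = ?D n" by simp
    ultimately show ?thesis using N0 by linarith
  qed
  moreover have "?D 0 = ?D n" by simp
  ultimately have "?N r = ?D r" if "r \<le> n" for r
    using mid[of r] N0 that by (metis bot_nat_0.not_eq_extremum le_neq_implies_less)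
  then show ?case using less.prems(4) by (simp add: n_def)
qed

section \<open>Partial sums and the vertices of a chamber simplex\<close>

text \<open>As \<open>ks\<close> decreases, its suffix starting with \<open>i\<close> consists of
  the indices in \<open>ks\<close> up to \<open>i\<close>.\<close>

lemma positive_suffixes_map:
  fixes g :: "'a::linorder \<Rightarrow> real"
  assumes "sorted_wrt (>) ks"
  shows "positive_suffixes (map g ks) = card {i \<in> set ks. (\<Sum>j | j \<in> set ks \<and> j \<le> i. g j) > 0}"
  using assms
proof (induction ks)
  case (Cons k ks)
  have lt: "j < k" if "j \<in> set ks" for j using Cons.prems that by auto
  then have nk: "k \<notin> set ks" by auto
  have "sorted_wrt (<) (rev ks)" using Cons.prems by (simp add: sorted_wrt_rev)
  then have "distinct ks" by (metis distinct_rev strict_sorted_iff)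
  have all: "{j. j \<in> set (k # ks) \<and> j \<le> k} = set (k # ks)" using lt less_imp_le by auto
  have "{j. j \<in> set (k # ks) \<and> j \<le> i} = {j. j \<in> set ks \<and> j \<le> i}" if "i \<in> set ks" for i
    using lt[OF that] by auto
  then have "{i \<in> set (k # ks). (\<Sum>j | j \<in> set (k # ks) \<and> j \<le> i. g j) > 0} =
      (if (\<Sum>j\<in>set (k # ks). g j) > 0 then {k} else {}) \<union>
      {i \<in> set ks. (\<Sum>j | j \<in> set ks \<and> j \<le> i. g j) > 0}"
    using all by auto
  moreover have "(\<Sum>j\<in>set (k # ks). g j) = g k + sum_list (map g ks)"
    using nk \<open>distinct ks\<close> by (simp add: sum_list_distinct_conv_sum_set)
  ultimately show ?case using Cons nk by (simp add: card_insert_if)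
qed auto

lemma sign_mult_self: "\<epsilon> \<in> sign_vectors \<Longrightarrow> \<epsilon> i * (\<epsilon> i * x) = x"
  by (auto simp: sign_vectors_def dest: spec[of _ i])

text \<open>
  A point with coordinates \<open>t\<close> in \<open>[0, 1]\<close> is the midpoint of the points with coordinates \<open>t\<^sup>2\<close> and
  \<open>2 t - t\<^sup>2\<close>. Both maps are monotone and preserve \<open>[0, 1]\<close>, hence preserve the simplex, and they
  differ unless \<open>t\<close> is \<open>0\<close> or \<open>1\<close>.
\<close>

lemma extreme_point_chamber_cube:
  fixes \<epsilon> :: "'n::{finite,linorder} \<Rightarrow> real"
  assumes e: "\<epsilon> \<in> sign_vectors" and s: "\<sigma> permutes UNIV"
  shows "v extreme_point_of (weyl_chamber_B \<epsilon> \<sigma> \<inter> symmetric_cube) \<longleftrightarrow>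
    v \<in> weyl_chamber_B \<epsilon> \<sigma> \<and> (\<forall>i. \<epsilon> i * v $ \<sigma> i \<in> {0, 1})"
proof -
  define P where "P = weyl_chamber_B \<epsilon> \<sigma> \<inter> symmetric_cube"
  have abs_e: "\<bar>\<epsilon> i\<bar> = 1" for i using e by (auto simp: sign_vectors_def dest: spec[of _ i])
  \<comment> \<open>In the chamber all signed coordinates are nonnegative, so of the cube only the
    upper bounds remain.\<close>
  have in_P: "x \<in> P \<longleftrightarrow> x \<in> weyl_chamber_B \<epsilon> \<sigma> \<and> (\<forall>i. \<epsilon> i * x $ \<sigma> i \<le> 1)" for x
  proof -
    have "x \<in> symmetric_cube \<longleftrightarrow> (\<forall>k. \<bar>x $ k\<bar> \<le> 1)"
      by (auto simp: symmetric_cube_def mem_box_cart abs_le_iff minus_le_iff)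
    also have "\<dots> \<longleftrightarrow> (\<forall>i. \<bar>x $ \<sigma> i\<bar> \<le> 1)"
      using s by (metis permutes_inverses(1))
    also have "\<dots> \<longleftrightarrow> (\<forall>i. \<bar>\<epsilon> i * x $ \<sigma> i\<bar> \<le> 1)"
      by (simp add: abs_mult abs_e)
    finally show ?thesis by (auto simp: P_def weyl_chamber_B_def abs_of_nonneg)
  qed
  have eqI: "x = y" if "\<And>i. \<epsilon> i * x $ \<sigma> i = \<epsilon> i * y $ \<sigma> i" for x y :: "real ^ 'n::{finite,linorder}"
  proof -
    have "x $ \<sigma> i = y $ \<sigma> i" for i using that[of i] abs_e[of i] by auto
    then show ?thesis using s by (metis permutes_inverses(1) vec_eq_iff)
  qed
  show ?thesis
    unfolding P_def[symmetric]
  proof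
    assume v: "v extreme_point_of P"
    then have vP: "v \<in> P" by (simp add: extreme_point_of_def)
    define y where "y = (\<lambda>i. \<epsilon> i * v $ \<sigma> i)"
    have y: "0 \<le> y i" "y i \<le> 1" for i using vP by (auto simp: in_P y_def weyl_chamber_B_def)
    have mono: "y j \<le> y i" if "i \<le> j" for i j
      using vP that by (auto simp: in_P y_def weyl_chamber_B_def)
    define pt where "pt = (\<lambda>f::real \<Rightarrow> real. \<chi> k. \<epsilon> (inv \<sigma> k) * f (y (inv \<sigma> k)))"
    have pt: "\<epsilon> i * pt f $ \<sigma> i = f (y i)" for f i
      using permutes_inverses(2)[OF s] by (simp add: pt_def sign_mult_self[OF e])
    have ptP: "pt f \<in> P"
      if f: "\<And>s t. 0 \<le> s \<Longrightarrow> s \<le> t \<Longrightarrow> t \<le> 1 \<Longrightarrow> f s \<le> f t" "f 0 = 0" "f 1 = 1" for f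
    proof -
      have "f (y j) \<le> f (y i)" if "i \<le> j" for i j by (rule f(1)[OF y(1) mono[OF that] y(2)])
      moreover have "0 \<le> f (y i)" "f (y i) \<le> 1" for i
        using f(1)[of 0 "y i"] f(1)[of "y i" 1] f(2,3) y[of i] by auto
      ultimately show ?thesis by (simp add: in_P weyl_chamber_B_def pt)
    qed
    let ?f = "\<lambda>t::real. t^2" and ?g = "\<lambda>t::real. 2 * t - t^2"
    have "pt ?f \<in> P" by (rule ptP) (auto intro: power_mono)
    moreover have "pt ?g \<in> P"
    proof (rule ptP)
      fix s t :: real assume st: "0 \<le> s" "s \<le> t" "t \<le> 1"
      have "0 \<le> (t - s) * (2 - t - s)" using st by (intro mult_nonneg_nonneg) auto
      then show "2 * s - s^2 \<le> 2 * t - t^2" by (simp add: algebra_simps power2_eq_square)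
    qed auto
    moreover have mid: "v = midpoint (pt ?f) (pt ?g)"
    proof (rule eqI)
      fix i
      have "\<epsilon> i * midpoint (pt ?f) (pt ?g) $ \<sigma> i = (\<epsilon> i * pt ?f $ \<sigma> i + \<epsilon> i * pt ?g $ \<sigma> i) / 2"
        by (simp add: midpoint_def distrib_left add_divide_distrib)
      also have "\<dots> = \<epsilon> i * v $ \<sigma> i" by (simp add: pt y_def)
      finally show "\<epsilon> i * v $ \<sigma> i = \<epsilon> i * midpoint (pt ?f) (pt ?g) $ \<sigma> i" by (rule sym)
    qed
    moreover have "p = q" if "p \<in> P" "q \<in> P" "v = midpoint p q" for p q
      using v that by (metis extreme_point_of_def midpoint_in_open_segment)
    ultimately have "pt ?f = pt ?g" by blast
    then have "y i ^ 2 = 2 * y i - y i ^ 2" for i using pt[of i ?f] pt[of i ?g] by simp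
    then have "y i * (1 - y i) = 0" for i by (simp add: right_diff_distrib power2_eq_square)
    then have "y i = 0 \<or> y i = 1" for i by (metis eq_iff_diff_eq_0 mult_eq_0_iff)
    then show "v \<in> weyl_chamber_B \<epsilon> \<sigma> \<and> (\<forall>i. \<epsilon> i * v $ \<sigma> i \<in> {0, 1})"
      using vP by (simp add: in_P y_def)
  next
    assume v: "v \<in> weyl_chamber_B \<epsilon> \<sigma> \<and> (\<forall>i. \<epsilon> i * v $ \<sigma> i \<in> {0, 1})"
    show "v extreme_point_of P"
      unfolding extreme_point_of_def
    proof (intro conjI ballI notI)
      have "\<epsilon> i * v $ \<sigma> i \<le> 1" for i using v by (metis insertE order_refl singletonD zero_le_one)
      then show "v \<in> P" using v in_P by blast
      fix p q assume pq: "p \<in> P" "q \<in> P" "v \<in> open_segment p q"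
      then obtain u where u: "p \<noteq> q" "0 < u" "u < 1" "v = (1 - u) *\<^sub>R p + u *\<^sub>R q"
        by (auto simp: in_segment)
      have "p = q"
      proof (rule eqI)
        fix i
        define s t where "s = \<epsilon> i * p $ \<sigma> i" "t = \<epsilon> i * q $ \<sigma> i"
        have st: "0 \<le> s" "s \<le> 1" "0 \<le> t" "t \<le> 1"
          using pq(1,2) by (auto simp: in_P s_t_def weyl_chamber_B_def)
        have "\<epsilon> i * v $ \<sigma> i = (1 - u) * s + u * t"
          by (simp add: u(4) s_t_def algebra_simps)
        \<comment> \<open>A convex combination of \<open>s\<close> and \<open>t\<close> with
          positive weights reaches an end of [0, 1] only if both lie there; the second case is the
          first one for \<open>1 - s\<close> and \<open>1 - t\<close>.\<close>
        then consider "(1 - u) * s + u * t = 0" | "(1 - u) * (1 - s) + u * (1 - t) = 0"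
        proof -
          have "\<epsilon> i * v $ \<sigma> i = 0 \<or> \<epsilon> i * v $ \<sigma> i = 1" using v by blast
          moreover have "(1 - u) * (1 - s) + u * (1 - t) = 1 - ((1 - u) * s + u * t)"
            by (simp add: algebra_simps)
          ultimately show ?thesis using that \<open>\<epsilon> i * v $ \<sigma> i = (1 - u) * s + u * t\<close> by linarith
        qed
        then have "s = t"
        proof cases
          case 1
          then show ?thesis using st u by (simp add: add_nonneg_eq_0_iff)
        next
          case 2
          then show ?thesis using st u by (simp add: add_nonneg_eq_0_iff)
        qed
        then show "\<epsilon> i * p $ \<sigma> i = \<epsilon> i * q $ \<sigma> i" by (simp add: s_t_def)
      qed
      then show False using u by simp
    qed
  qed
qed

text \<open>In signed coordinates the vertices are the indicators \<open>w J\<close> of initial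
  segments \<open>J\<close>, and \<open>a \<bullet> w J\<close> is the partial sum over
  \<open>J\<close>.\<close>

lemma num_vertices_chamber_cube:
  fixes \<epsilon> :: "'n::{finite,linorder} \<Rightarrow> real"
  assumes e: "\<epsilon> \<in> sign_vectors" and s: "\<sigma> permutes UNIV"
  shows "num_vertices_in {x. a \<bullet> x > 0} (weyl_chamber_B \<epsilon> \<sigma> \<inter> symmetric_cube) =
    card {i. (\<Sum>j | j \<le> i. \<epsilon> j * a $ \<sigma> j) > 0}"
proof -
  define w :: "'n set \<Rightarrow> real ^ 'n::{finite,linorder}" where
    "w = (\<lambda>J. \<chi> k. if inv \<sigma> k \<in> J then \<epsilon> (inv \<sigma> k) else 0)"
  have ww: "\<epsilon> i * w J $ \<sigma> i = (if i \<in> J then 1 else 0)" for i J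
    using permutes_inverses(2)[OF s] sign_mult_self[OF e, of i 1] by (simp add: w_def)
  have inner: "a \<bullet> w J = (\<Sum>j\<in>J. \<epsilon> j * a $ \<sigma> j)" for J
  proof -
    have "a \<bullet> w J = (\<Sum>k\<in>UNIV. a $ k * w J $ k)" by (simp add: inner_vec_def)
    also have "\<dots> = (\<Sum>i\<in>UNIV. a $ \<sigma> i * w J $ \<sigma> i)"
      using sum.permute[OF s, of "\<lambda>k. a $ k * w J $ k"] by (simp add: o_def)
    also have "\<dots> = (\<Sum>i\<in>UNIV. if i \<in> J then \<epsilon> i * a $ \<sigma> i else 0)"
      using permutes_inverses(2)[OF s] by (intro sum.cong) (auto simp: w_def)
    finally show ?thesis by (simp add: sum.If_cases)
  qed
  have inj: "inj w" using ww by (metis (no_types, opaque_lifting) inj_onI set_eqI zero_neq_one)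
  have ext: "v extreme_point_of (weyl_chamber_B \<epsilon> \<sigma> \<inter> symmetric_cube) \<longleftrightarrow>
      v = w {} \<or> (\<exists>i. v = w {..i})" for v
  proof
    assume "v extreme_point_of (weyl_chamber_B \<epsilon> \<sigma> \<inter> symmetric_cube)"
    then have v: "v \<in> weyl_chamber_B \<epsilon> \<sigma>" "\<And>i. \<epsilon> i * v $ \<sigma> i \<in> {0, 1}"
      using extreme_point_chamber_cube[OF e s] by auto
    define J where "J = {i. \<epsilon> i * v $ \<sigma> i = 1}"
    have "v $ k = w J $ k" for k
    proof -
      define i where "i = inv \<sigma> k"
      have k: "k = \<sigma> i" using permutes_inverses(1)[OF s] by (simp add: i_def)
      have "\<epsilon> i * v $ \<sigma> i = \<epsilon> i * w J $ \<sigma> i" using v(2)[of i] by (auto simp: ww J_def)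
      then show ?thesis unfolding k by (metis sign_mult_self[OF e])
    qed
    then have vw: "v = w J" by (simp add: vec_eq_iff)
    \<comment> \<open>The chamber inequalities make \<open>J\<close> closed downwards; in a finite
      linear order it is then empty or \<open>{..Max J}\<close>.\<close>
    have down: "i \<in> J" if "j \<in> J" "i \<le> j" for i j
    proof -
      have "\<epsilon> i * v $ \<sigma> i \<ge> \<epsilon> j * v $ \<sigma> j" using v(1) that(2) by (auto simp: weyl_chamber_B_def)
      then show ?thesis using v(2)[of i] that(1) by (auto simp: J_def)
    qed
    show "v = w {} \<or> (\<exists>i. v = w {..i})"
    proof (cases "J = {}")
      case False
      have "Max J \<in> J" using Max_in[of J] False by simp
      moreover have "i \<le> Max J" if "i \<in> J" for i using Max_ge[of J i] that by simp
      ultimately have "J = {..Max J}" using down[of "Max J"] by blast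
      then show ?thesis using vw by metis
    qed (use vw in auto)
  next
    assume "v = w {} \<or> (\<exists>i. v = w {..i})"
    then obtain J where J: "v = w J" "J = {} \<or> (\<exists>i. J = {..i})" by auto
    then have "i \<in> J" if "j \<in> J" "i \<le> j" for i j using that order_trans by auto
    with J(1) show "v extreme_point_of (weyl_chamber_B \<epsilon> \<sigma> \<inter> symmetric_cube)"
      unfolding extreme_point_chamber_cube[OF e s] by (auto simp: weyl_chamber_B_def ww)
  qed
  \<comment> \<open>The vertex \<open>w {}\<close> is the origin, whose inner product with
    \<open>a\<close> is 0, so it is never counted.\<close>
  have "{v \<in> {x. a \<bullet> x > 0}. v extreme_point_of (weyl_chamber_B \<epsilon> \<sigma> \<inter> symmetric_cube)} =
      (\<lambda>i. w {..i}) ` {i. (\<Sum>j | j \<le> i. \<epsilon> j * a $ \<sigma> j) > 0}"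
    unfolding ext by (auto simp: inner atMost_def)
  moreover have "inj (\<lambda>i. w {..i})"
    using inj by (auto simp: inj_def)
  ultimately show ?thesis
    unfolding num_vertices_in_def by (simp add: card_image inj_on_subset)
qed

section \<open>General position as absence of signed relations\<close>

text \<open>The intersection \<open>K\<close> of all arrangement hyperplanes through
  \<open>v\<close> lies in the line spanned by \<open>v\<close>, so general position lets the
  hyperplane orthogonal to \<open>a\<close> meet \<open>K\<close> only in 0.\<close>

lemma general_position_inner_nonzero:
  fixes a v :: "real ^ 'n::{finite,linorder}"
  assumes gp: "general_position_B {x. a \<bullet> x = 0}"
    and v: "\<And>i. v $ i \<in> {-1, 0, 1}" "v \<noteq> 0"
  shows "a \<bullet> v \<noteq> 0"
proof
  assume av: "a \<bullet> v = 0"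
  define K where "K = \<Inter>{h \<in> reflection_arrangement_B. v \<in> h}"
  have K: "K \<in> intersection_lattice_B" unfolding K_def intersection_lattice_B_def by blast
  have vK: "v \<in> K" by (auto simp: K_def)
  obtain l where l: "v $ l \<noteq> 0" using v(2) by (auto simp: vec_eq_iff)
  have "K \<subseteq> span {v}"
  proof
    fix x assume x: "x \<in> K"
    have zero: "x $ i = 0" if "v $ i = 0" for i
    proof -
      have "{\<beta>. \<beta> $ i = 0} \<in> reflection_arrangement_B" by (auto simp: reflection_arrangement_B_def)
      then show ?thesis using x that by (auto simp: K_def)
    qed
    have eq: "x $ i = x $ j" if "v $ i = v $ j" "i < j" for i j
    proof -
      have "{\<beta>. \<beta> $ i = \<beta> $ j} \<in> reflection_arrangement_B"
        using that by (auto simp: reflection_arrangement_B_def)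
      then show ?thesis using x that by (auto simp: K_def)
    qed
    have neg: "x $ i = - x $ j" if "v $ i = - v $ j" "i < j" for i j
    proof -
      have "{\<beta>. \<beta> $ i = - \<beta> $ j} \<in> reflection_arrangement_B"
        using that by (auto simp: reflection_arrangement_B_def)
      then show ?thesis using x that by (auto simp: K_def)
    qed
    \<comment> \<open>Every nonzero coordinate of \<open>v\<close> is plus or minus
      \<open>v $ l\<close>, so the equations defining \<open>K\<close> express \<open>x $ i\<close>
      through \<open>x $ l\<close>.\<close>
    have "x $ i = (x $ l / v $ l) * v $ i" for i
    proof -
      have "v $ k = -1 \<or> v $ k = 0 \<or> v $ k = 1" for k using v(1)[of k] by simp
      from this[of i] this[of l] l have "v $ i = 0 \<or> v $ i = v $ l \<or> v $ i = - v $ l"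
        by (elim disjE) simp_all
      then consider "v $ i = 0" | "v $ i = v $ l" | "v $ i = - v $ l" by blast
      then show ?thesis
      proof cases
        case 1
        then show ?thesis using zero by simp
      next
        case 2
        then have "x $ i = x $ l" using eq by (metis neqE)
        then show ?thesis using 2 l by simp
      next
        case 3
        then have "x $ i = - x $ l"
          using neg l by (metis add.inverse_inverse equal_neg_zero neqE)
        then show ?thesis using 3 l by simp
      qed
    qed
    then have "x = (x $ l / v $ l) *\<^sub>R v"
      unfolding vec_eq_iff vector_scaleR_component real_scaleR_def by blast
    then show "x \<in> span {v}" by (metis span_base span_scale singletonI)
  qed
  then have "dim K \<le> 1" using dim_subset[of K "span {v}"] dim_singleton[of v] v(2) by simp
  then have "dim ({x. a \<bullet> x = 0} \<inter> K) = 0"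
    using gp K by (auto simp: general_position_B_def)
  then have "v \<in> {0}" using vK av by (auto simp: dim_eq_0)
  then show False using v(2) by simp
qed

text \<open>The frontier is the level set \<open>a \<bullet> x = b\<close>; as a subspace it
  contains 0, which forces \<open>b = 0\<close>.\<close>

lemma open_half_space_frontier_subspace:
  assumes "open_half_space H" "frontier H = L" "subspace L"
  obtains a where "H = {x. a \<bullet> x > 0}" "L = {x. a \<bullet> x = 0}"
proof -
  obtain a b where ab: "a \<noteq> 0" "H = {x. a \<bullet> x > b}"
    using assms(1) by (auto simp: open_half_space_def)
  have L: "L = {x. a \<bullet> x = b}" using assms(2) ab frontier_halfspace_gt[of a b] by simp
  then have "b = 0" using subspace_0[OF assms(3)] by simp
  then show thesis using that[of a] ab L by simp
qed

text \<open>If two coordinates of \<open>a\<close> agree up to a sign \<open>s\<close>, then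
  \<open>a\<close> is orthogonal to a vector with entries 1, \<open>- s\<close> and otherwise
  0.\<close>

lemma general_position_inj_abs:
  fixes a :: "real ^ 'n::{finite,linorder}"
  assumes gp: "general_position_B {x. a \<bullet> x = 0}"
  shows "inj (\<lambda>i. \<bar>a $ i\<bar>)"
proof (rule injI, rule ccontr)
  fix i j assume ij: "\<bar>a $ i\<bar> = \<bar>a $ j\<bar>" "i \<noteq> j"
  obtain s :: real where s: "s = 1 \<or> s = -1" "a $ i = s * a $ j"
    using ij(1) by (metis abs_eq_iff mult_1 mult_minus1)
  let ?v = "axis i 1 - axis j s :: real ^ 'n::{finite,linorder}"
  have "?v $ k \<in> {-1, 0, 1}" for k using s(1) ij(2) by (auto simp: axis_def)
  moreover have "?v $ i \<noteq> 0" using ij(2) by (simp add: axis_def)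
  then have "?v \<noteq> 0" by (metis zero_index)
  moreover have "a \<bullet> ?v = 0" using s(2) by (simp add: inner_diff_right inner_axis mult.commute)
  ultimately show False using general_position_inner_nonzero[OF gp] by blast
qed

lemma general_position_nonzero:
  fixes a :: "real ^ 'n::{finite,linorder}"
  assumes gp: "general_position_B {x. a \<bullet> x = 0}"
  shows "a $ i \<noteq> 0"
proof -
  have "axis i 1 $ k \<in> {-1, 0, 1 :: real}" for k by (simp add: axis_def)
  moreover have "axis i (1::real) \<noteq> 0" by (simp add: axis_eq_0_iff)
  ultimately have "a \<bullet> axis i 1 \<noteq> 0" by (rule general_position_inner_nonzero[OF gp])
  then show ?thesis by (simp add: inner_axis)
qed

text \<open>A signed sum of distinct step sizes is the inner product of \<open>a\<close> with a
  nonzero vector with entries in -1, 0, 1.\<close>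

lemma general_position_signed_sum_free:
  fixes a :: "real ^ 'n::{finite,linorder}"
  assumes gp: "general_position_B {x. a \<bullet> x = 0}"
  shows "signed_sum_free (range (\<lambda>i. \<bar>a $ i\<bar>))"
  unfolding signed_sum_free_def
proof (intro allI impI)
  fix zs :: "real list"
  assume zs: "zs \<noteq> []" "distinct (map abs zs)" "abs ` set zs \<subseteq> range (\<lambda>i. \<bar>a $ i\<bar>)"
  have inj_abs: "x = y" if "x \<in> set zs" "y \<in> set zs" "\<bar>x\<bar> = \<bar>y\<bar>" for x y
    using zs(2) that by (auto simp: distinct_map inj_on_def)
  \<comment> \<open>\<open>v\<close> records the sign with which each \<open>a $ i\<close> enters
    the list. Since absolute values in \<open>zs\<close> are distinct and \<open>a $ i\<close> is
    nonzero, \<open>a $ i\<close> and \<open>- a $ i\<close> are never both entries.\<close>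
  define v :: "real ^ 'n::{finite,linorder}" where
    "v = (\<chi> i. if a $ i \<in> set zs then 1 else if - a $ i \<in> set zs then -1 else 0)"
  have v: "v $ i \<in> {-1, 0, 1}" for i by (simp add: v_def)
  have hit: "\<exists>i. v $ i \<noteq> 0 \<and> a $ i * v $ i = z" if z: "z \<in> set zs" for z
  proof -
    obtain i where i: "\<bar>z\<bar> = \<bar>a $ i\<bar>" using zs(3) z by auto
    have "a $ i = z" if "a $ i \<in> set zs" using inj_abs[OF z that] i by simp
    moreover have "a $ i = z \<or> - a $ i = z" using i by (auto simp: abs_if split: if_splits)
    ultimately have "v $ i \<noteq> 0 \<and> a $ i * v $ i = z" using z by (auto simp: v_def)
    then show ?thesis by blast
  qed
  obtain z where "z \<in> set zs" using zs(1) by (cases zs) auto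
  then have "v \<noteq> 0" using hit by (metis zero_index)
  then have "a \<bullet> v \<noteq> 0" using general_position_inner_nonzero[OF gp v] by blast
  moreover have "a \<bullet> v = sum_list zs"
  proof -
    let ?I = "{i. v $ i \<noteq> 0}"
    have img: "(\<lambda>i. a $ i * v $ i) ` ?I = set zs"
    proof
      show "(\<lambda>i. a $ i * v $ i) ` ?I \<subseteq> set zs" by (auto simp: v_def split: if_splits)
      show "set zs \<subseteq> (\<lambda>i. a $ i * v $ i) ` ?I" using hit by (force simp: image_iff)
    qed
    have "inj_on (\<lambda>i. a $ i * v $ i) ?I"
    proof (rule inj_onI)
      fix i j assume h: "i \<in> ?I" "j \<in> ?I" "a $ i * v $ i = a $ j * v $ j"
      have "\<bar>v $ i\<bar> = 1" "\<bar>v $ j\<bar> = 1" using h v[of i] v[of j] by auto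
      then have "\<bar>a $ i\<bar> = \<bar>a $ j\<bar>" using arg_cong[OF h(3), of abs] by (simp add: abs_mult)
      then show "i = j" using injD[OF general_position_inj_abs[OF gp]] by blast
    qed
    then have "(\<Sum>i\<in>?I. a $ i * v $ i) = \<Sum>(set zs)"
      by (simp add: sum.reindex flip: img)
    moreover have "a \<bullet> v = (\<Sum>i\<in>?I. a $ i * v $ i)"
      unfolding inner_vec_def by (simp, intro sum.mono_neutral_right) auto
    moreover have "distinct zs" using zs(2) distinct_map by blast
    ultimately show ?thesis by (simp add: distinct_sum_list_conv_Sum)
  qed
  ultimately show "sum_list zs \<noteq> 0" by simp
qed

section \<open>From chambers to lists of steps\<close>

text \<open>Absolute values of the steps recover \<open>\<sigma>\<close>, and then the nonzero steps
  recover \<open>\<epsilon>\<close>; surjectivity follows because both sides have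
  \<open>2 ^ n * fact n\<close> elements, with \<open>n = CARD('n)\<close>.\<close>

lemma bij_betw_signed_arrangements:
  fixes c :: "'n::finite \<Rightarrow> real"
  assumes nz: "\<And>i. c i \<noteq> 0" and inj: "inj (\<lambda>i. \<bar>c i\<bar>)" and ks: "distinct ks" "set ks = UNIV"
  shows "bij_betw (\<lambda>(\<epsilon>, \<sigma>). map (\<lambda>i. \<epsilon> i * c (\<sigma> i)) ks)
    (sign_vectors \<times> {\<sigma>. \<sigma> permutes UNIV}) (signed_arrangements (range (\<lambda>i. \<bar>c i\<bar>)))"
    (is "bij_betw ?\<Phi> ?S ?Z")
proof -
  let ?A = "range (\<lambda>i. \<bar>c i\<bar>)"
  have e1: "\<bar>\<epsilon> i\<bar> = 1" if "\<epsilon> \<in> sign_vectors" for \<epsilon> :: "'n \<Rightarrow> real" and i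
    using that by (auto simp: sign_vectors_def dest: spec[of _ i])
  have injP: "inj_on ?\<Phi> ?S"
  proof (rule inj_onI, clarify)
    fix \<epsilon> \<epsilon>' :: "'n \<Rightarrow> real" and \<sigma> \<sigma>' :: "'n \<Rightarrow> 'n"
    assume e: "\<epsilon> \<in> sign_vectors" "\<epsilon>' \<in> sign_vectors"
      and "map (\<lambda>i. \<epsilon> i * c (\<sigma> i)) ks = map (\<lambda>i. \<epsilon>' i * c (\<sigma>' i)) ks"
    then have eq: "\<epsilon> i * c (\<sigma> i) = \<epsilon>' i * c (\<sigma>' i)" for i using ks(2) by simp
    have "\<bar>c (\<sigma> i)\<bar> = \<bar>c (\<sigma>' i)\<bar>" for i
      using arg_cong[OF eq[of i], of abs] e1[OF e(1)] e1[OF e(2)] by (simp add: abs_mult)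
    then have "\<sigma> = \<sigma>'" using injD[OF inj] by blast
    moreover from this have "\<epsilon> = \<epsilon>'" using eq nz by auto
    ultimately show "\<epsilon> = \<epsilon>' \<and> \<sigma> = \<sigma>'" by simp
  qed
  have sub: "?\<Phi> ` ?S \<subseteq> ?Z"
  proof clarify
    fix \<epsilon> :: "'n \<Rightarrow> real" and \<sigma> :: "'n \<Rightarrow> 'n"
    assume e: "\<epsilon> \<in> sign_vectors" and s: "\<sigma> permutes UNIV"
    have m: "map abs (map (\<lambda>i. \<epsilon> i * c (\<sigma> i)) ks) = map (\<lambda>i. \<bar>c i\<bar>) (map \<sigma> ks)"
      using e1[OF e] by (simp add: abs_mult)
    have "inj \<sigma>" "range \<sigma> = UNIV" using permutes_inj[OF s] permutes_surj[OF s] by auto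
    moreover from this(2) have "set (map (\<lambda>i. \<bar>c i\<bar>) (map \<sigma> ks)) = ?A"
      by (simp only: list.set_map ks(2))
    moreover have "distinct (map (\<lambda>i. \<bar>c i\<bar>) (map \<sigma> ks))"
      using ks inj \<open>inj \<sigma>\<close> inj_on_subset[OF inj] by (simp add: distinct_map del: map_map)
    ultimately show "map (\<lambda>i. \<epsilon> i * c (\<sigma> i)) ks \<in> ?Z"
      unfolding signed_arrangements_def m mem_Collect_eq list.set_map[symmetric] by blast
  qed
  have "card ?Z = 2 ^ CARD('n) * fact CARD('n)"
  proof -
    have "?A \<subseteq> {0<..}" using nz by (auto simp only: greaterThan_iff zero_less_abs_iff)
    then show ?thesis using card_signed_arrangements[of ?A] card_image[OF inj] by simp
  qed
  also have "\<dots> = card ?S"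
    using card_permutations[of "UNIV :: 'n set"] by (simp add: card_cartesian_product card_sign_vectors)
  finally have "?\<Phi> ` ?S = ?Z"
    using card_image[OF injP] finite_signed_arrangements[of ?A]
    by (intro card_subset_eq[OF _ sub]) auto
  with injP show ?thesis by (simp add: bij_betw_def)
qed

theorem corollary2p2:
  fixes L H :: "(real ^ 'n::{finite,linorder}) set" and m :: nat
  assumes "linear_hyperplane L"
    and "general_position_B L"
    and "open_half_space H" and "frontier H = L"
    and "m \<le> CARD('n)"
  shows "measure_pmf.prob (pmf_of_set (weyl_chambers_B :: (real ^ 'n::{finite,linorder}) set set))
           {Q. num_vertices_in H (Q \<inter> symmetric_cube) = m}
         = 1 / 2 ^ (2 * CARD('n)) * real ((2 * m) choose m)
           * real ((2 * CARD('n) - 2 * m) choose (CARD('n) - m))"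
proof -
  let ?n = "CARD('n)"
  let ?W = "weyl_chambers_B :: (real ^ 'n::{finite,linorder}) set set"
  let ?S = "(sign_vectors :: ('n \<Rightarrow> real) set) \<times> {\<sigma>::'n \<Rightarrow> 'n. \<sigma> permutes UNIV}"
  obtain a where a: "H = {x. a \<bullet> x > 0}" "L = {x. a \<bullet> x = 0}"
    using open_half_space_frontier_subspace assms(1,3,4) unfolding linear_hyperplane_def by metis
  have gp: "general_position_B {x. a \<bullet> x = 0}" using assms(2) a(2) by simp
  note inj = general_position_inj_abs[OF gp] and nz = general_position_nonzero[OF gp]
  define A where "A = range (\<lambda>i. \<bar>a $ i\<bar>)"
  have A: "finite A" "A \<subseteq> {0<..}" "signed_sum_free A" "card A = ?n"
    using nz general_position_signed_sum_free[OF gp] card_image[OF inj] by (auto simp: A_def)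
  \<comment> \<open>Listing the indices in decreasing order turns suffixes into initial segments of
    the index order.\<close>
  define ks where "ks = rev (sorted_list_of_set (UNIV :: 'n set))"
  have ks: "distinct ks" "set ks = UNIV" "sorted_wrt (>) ks"
    by (simp_all add: ks_def sorted_wrt_rev)
  define \<Phi> where "\<Phi> = (\<lambda>(\<epsilon> :: 'n \<Rightarrow> real, \<sigma>). map (\<lambda>i. \<epsilon> i * a $ \<sigma> i) ks)"
  have bij: "bij_betw \<Phi> ?S (signed_arrangements A)"
    unfolding \<Phi>_def A_def using nz inj ks by (intro bij_betw_signed_arrangements)
  \<comment> \<open>Signed permutations parametrise the chambers by \<open>\<Psi>\<close> and the
    lists of steps by \<open>\<Phi>\<close>, both bijectively, so counting chambers amounts to
    counting lists.\<close>
  define \<Psi> :: "('n \<Rightarrow> real) \<times> ('n \<Rightarrow> 'n) \<Rightarrow> (real ^ 'n::{finite,linorder}) set"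
    where "\<Psi> = (\<lambda>(\<epsilon>, \<sigma>). weyl_chamber_B \<epsilon> \<sigma>)"
  have W: "?W = \<Psi> ` ?S" unfolding weyl_chambers_B_def \<Psi>_def by auto
  have inj\<Psi>: "inj_on \<Psi> ?S" by (intro inj_onI) (auto simp: \<Psi>_def dest: weyl_chamber_B_inj)
  have num: "num_vertices_in H (\<Psi> p \<inter> symmetric_cube) = positive_suffixes (\<Phi> p)" if "p \<in> ?S" for p
  proof -
    obtain \<epsilon> \<sigma> where p: "p = (\<epsilon>, \<sigma>)" by (cases p)
    then show ?thesis
      using that positive_suffixes_map[OF ks(3), of "\<lambda>i. \<epsilon> i * a $ \<sigma> i"]
      by (simp add: \<Phi>_def \<Psi>_def a(1) ks(2) num_vertices_chamber_cube)
  qed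
  let ?T = "{p \<in> ?S. positive_suffixes (\<Phi> p) = m}"
  have img: "{y \<in> f ` S. R y} = f ` {x \<in> S. R (f x)}" for f :: "'x \<Rightarrow> 'y" and S R by blast
  have "{Q \<in> ?W. num_vertices_in H (Q \<inter> symmetric_cube) = m} =
      \<Psi> ` {p \<in> ?S. num_vertices_in H (\<Psi> p \<inter> symmetric_cube) = m}"
    unfolding W by (rule img)
  also have "{p \<in> ?S. num_vertices_in H (\<Psi> p \<inter> symmetric_cube) = m} = ?T"
    by (rule Collect_cong) (metis num)
  finally have "card {Q \<in> ?W. num_vertices_in H (Q \<inter> symmetric_cube) = m} = card (\<Psi> ` ?T)"
    by simp
  also have "\<dots> = card ?T"
    by (rule card_image, rule inj_on_subset[OF inj\<Psi>], rule Collect_restrict)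
  also have "\<dots> = card (\<Phi> ` ?T)"
    by (rule card_image[symmetric], rule inj_on_subset[OF bij_betw_imp_inj_on[OF bij]],
        rule Collect_restrict)
  also have "\<Phi> ` ?T = {zs \<in> signed_arrangements A. positive_suffixes zs = m}"
    unfolding bij_betw_imp_surj_on[OF bij, symmetric] by (rule img[symmetric])
  also have "card \<dots> = card {zs \<in> signed_arrangements A. first_max zs = m}"
    by (simp add: card_first_max_eq_card_positive_suffixes[OF A(1)])
  finally have "real (card {Q \<in> ?W. num_vertices_in H (Q \<inter> symmetric_cube) = m}) =
      2 ^ ?n * fact ?n * (real ((2 * m) choose m) * real ((2 * (?n - m)) choose (?n - m)) / 4 ^ ?n)"
    using card_first_max[OF A(1-3), of m] binomial_positive_walks[OF assms(5)] A(4) assms(5) by simp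
  moreover have "?W \<inter> {Q. num_vertices_in H (Q \<inter> symmetric_cube) = m} =
      {Q \<in> ?W. num_vertices_in H (Q \<inter> symmetric_cube) = m}" by blast
  \<comment> \<open>Dividing by the number of chambers cancels \<open>2 ^ n * fact n\<close> and
    leaves the arcsine weight, with \<open>4 ^ n\<close> written as
    \<open>2 ^ (2 * n)\<close>.\<close>
  ultimately show ?thesis
    by (simp add: measure_pmf_of_set[OF weyl_chambers_B_nonempty finite_weyl_chambers_B]
        card_weyl_chambers_B power_mult diff_mult_distrib2)
qed

end
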